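(* Let $\mathcal{A}=\langle X,\mathcal{N},f\rangle$ be a cellular automaton with alphabet $A$ and tessellation group $G$, let $\Gamma$ be a finitely generated group with $G\leq\Gamma$, and let $\mathcal{A}'$ be the cellular automaton induced by $\mathcal{A}$ on $\Gamma$. Then: (1) $\mathcal{A}$ is surjective if and only if $\mathcal{A}'$ is surjective; (2) $\mathcal{A}$ is preinjective if and only if $\mathcal{A}'$ is preinjective; (3) $\mathcal{A}$ is injective if and only if $\mathcal{A}'$ is injective.
   Context: An alphabet is a finite set with at least two elements, given the discrete topology; tessellation groups are finitely generated; $G\le\Gamma$ means $G$ is a subgroup of $\Gamma$. For a group $H$, $A^H$ has the product topology, and for $c\in A^H$, $g\in H$, $c^g\in A^H$ is given by $c^g(h)=c(gh)$. A subshift of $A^H$ is a closed subset invariant under all the maps $c\mapsto c^g$, $g\in H$. A pattern is a map $p:E\to A$ with $E=\mathrm{supp}\,p$ finite; for $\mathrm{supp}\,p\subseteq H$, it occurs in $c\in A^H$ if $c^g|_{\mathrm{supp}\,p}=p$ for some $g\in H$. For a set $\mathcal{F}$ of patterns with supports in $H$, $\mathsf{X}^{A,H}_{\mathcal{F}}$ is the set of $c\in A^H$ in which no $p\in\mathcal{F}$ occurs; the subshifts of $A^H$ are exactly the sets of this form. For finite $\mathcal{N}\subseteq H$ and $f:A^{\mathcal{N}}\to A$, $(F^{A,H}_f(c))(g)=f(c^g|_{\mathcal{N}})$. A cellular automaton (CA) with alphabet $A$ and tessellation group $H$ is a triple $\mathcal{A}=\langle X,\mathcal{N},f\rangle$ with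 $X\subseteq A^H$ a subshift (the support), $\mathcal{N}\subseteq H$ finite, $f:A^{\mathcal{N}}\to A$, and $F^{A,H}_f(X)\subseteq X$; $F_{\mathcal{A}}:X\to X$ is the restriction of $F^{A,H}_f$ to $X$. $\mathcal{A}$ is surjective (injective) if $F_{\mathcal{A}}:X\to X$ is. $\mathcal{A}$ is preinjective if $F_{\mathcal{A}}(c_1)\neq F_{\mathcal{A}}(c_2)$ for any $c_1,c_2\in X$ such that $\{g\in H\mid c_1(g)\neq c_2(g)\}$ is finite and nonempty. If $X=\mathsf{X}^{A,G}_{\mathcal{F}}$ is a subshift of $A^G$ and $G\leq\Gamma$, the subshift induced by $X$ on $A^\Gamma$ is $X'=\mathsf{X}^{A,\Gamma}_{\mathcal{F}}$ (this does not depend on the choice of $\mathcal{F}$). The CA induced by $\mathcal{A}=\langle X,\mathcal{N},f\rangle$ on $\Gamma$ is $\mathcal{A}'=\langle X',\mathcal{N},f\rangle$ (with tessellation group $\Gamma$); it is a well-defined CA. *)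

theory Defs
  imports "HOL-Analysis.Analysis" "HOL-Algebra.Generated_Groups"
begin

definition alphabet :: "'a set \<Rightarrow> bool" where
  "alphabet A \<longleftrightarrow> finite A \<and> card A \<ge> 2"

definition finitely_generated_group :: "('g, 'm) monoid_scheme \<Rightarrow> bool" where
  "finitely_generated_group H \<longleftrightarrow>
     group H \<and> (\<exists>S. finite S \<and> S \<subseteq> carrier H \<and> generate H S = carrier H)"

text \<open>Elements of \<open>A\<^sup>H\<close> are functions on the carrier that are \<open>undefined\<close> outside it, so that
  equality of configurations is equality in HOL.\<close>

definition configs :: "'a set \<Rightarrow> ('g, 'm) monoid_scheme \<Rightarrow> ('g \<Rightarrow> 'a) set" where
  "configs A H = (carrier H \<rightarrow>\<^sub>E A)"

definition config_topology :: "'a set \<Rightarrow> ('g, 'm) monoid_scheme \<Rightarrow> ('g \<Rightarrow> 'a) topology" where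
  "config_topology A H = product_topology (\<lambda>_. discrete_topology A) (carrier H)"

definition translate :: "('g, 'm) monoid_scheme \<Rightarrow> ('g \<Rightarrow> 'a) \<Rightarrow> 'g \<Rightarrow> 'g \<Rightarrow> 'a" where
  "translate H c g = (\<lambda>h\<in>carrier H. c (g \<otimes>\<^bsub>H\<^esub> h))"

definition subshift :: "'a set \<Rightarrow> ('g, 'm) monoid_scheme \<Rightarrow> ('g \<Rightarrow> 'a) set \<Rightarrow> bool" where
  "subshift A H X \<longleftrightarrow>
     closedin (config_topology A H) X \<and> (\<forall>c\<in>X. \<forall>g\<in>carrier H. translate H c g \<in> X)"

text \<open>A pattern \<open>p : E \<rightarrow> A\<close> is a partial function; its support \<open>E\<close> is \<open>dom p\<close>.\<close>

definition pattern :: "'a set \<Rightarrow> ('g, 'm) monoid_scheme \<Rightarrow> ('g \<rightharpoonup> 'a) \<Rightarrow> bool" where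
  "pattern A H p \<longleftrightarrow> finite (dom p) \<and> dom p \<subseteq> carrier H \<and> ran p \<subseteq> A"

definition occurs :: "('g, 'm) monoid_scheme \<Rightarrow> ('g \<rightharpoonup> 'a) \<Rightarrow> ('g \<Rightarrow> 'a) \<Rightarrow> bool" where
  "occurs H p c \<longleftrightarrow> (\<exists>g\<in>carrier H. (Some \<circ> translate H c g) |` dom p = p)"

definition avoiding ::
  "'a set \<Rightarrow> ('g, 'm) monoid_scheme \<Rightarrow> ('g \<rightharpoonup> 'a) set \<Rightarrow> ('g \<Rightarrow> 'a) set" where
  "avoiding A H \<F> = {c \<in> configs A H. \<forall>p\<in>\<F>. \<not> occurs H p c}"

record ('g, 'a) ca =
  support :: "('g \<Rightarrow> 'a) set"
  neighborhood :: "'g set"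
  local_rule :: "('g \<Rightarrow> 'a) \<Rightarrow> 'a"

definition ca_map :: "('g, 'm) monoid_scheme \<Rightarrow> ('g, 'a) ca \<Rightarrow> ('g \<Rightarrow> 'a) \<Rightarrow> 'g \<Rightarrow> 'a" where
  "ca_map H \<A> c =
     (\<lambda>g\<in>carrier H. local_rule \<A> (restrict (translate H c g) (neighborhood \<A>)))"

definition cellular_automaton :: "'a set \<Rightarrow> ('g, 'm) monoid_scheme \<Rightarrow> ('g, 'a) ca \<Rightarrow> bool" where
  "cellular_automaton A H \<A> \<longleftrightarrow>
     subshift A H (support \<A>) \<and>
     finite (neighborhood \<A>) \<and> neighborhood \<A> \<subseteq> carrier H \<and>
     local_rule \<A> \<in> (neighborhood \<A> \<rightarrow>\<^sub>E A) \<rightarrow> A \<and>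
     ca_map H \<A> ` support \<A> \<subseteq> support \<A>"

definition ca_surjective :: "('g, 'm) monoid_scheme \<Rightarrow> ('g, 'a) ca \<Rightarrow> bool" where
  "ca_surjective H \<A> \<longleftrightarrow> ca_map H \<A> ` support \<A> = support \<A>"

definition ca_injective :: "('g, 'm) monoid_scheme \<Rightarrow> ('g, 'a) ca \<Rightarrow> bool" where
  "ca_injective H \<A> \<longleftrightarrow> inj_on (ca_map H \<A>) (support \<A>)"

definition ca_preinjective :: "('g, 'm) monoid_scheme \<Rightarrow> ('g, 'a) ca \<Rightarrow> bool" where
  "ca_preinjective H \<A> \<longleftrightarrow>
     (\<forall>c1\<in>support \<A>. \<forall>c2\<in>support \<A>.
        finite {g \<in> carrier H. c1 g \<noteq> c2 g} \<and> {g \<in> carrier H. c1 g \<noteq> c2 g} \<noteq> {} \<longrightarrow>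
        ca_map H \<A> c1 \<noteq> ca_map H \<A> c2)"

text \<open>The description exists and is unique whenever \<open>X\<close> is a subshift of \<open>A\<^sup>G\<close> and \<open>G\<close> is a
  subgroup of \<open>\<Gamma>\<close>; see \<open>subshift_eq_avoiding\<close> and \<open>induced_subshift_avoiding\<close> below.\<close>

definition induced_subshift ::
  "'a set \<Rightarrow> ('g, 'm) monoid_scheme \<Rightarrow> ('g, 'n) monoid_scheme \<Rightarrow> ('g \<Rightarrow> 'a) set \<Rightarrow> ('g \<Rightarrow> 'a) set"
  where
  "induced_subshift A G \<Gamma> X =
     (THE X'. \<exists>\<F>. (\<forall>p\<in>\<F>. pattern A G p) \<and> X = avoiding A G \<F> \<and> X' = avoiding A \<Gamma> \<F>)"

definition induced_ca ::
  "'a set \<Rightarrow> ('g, 'm) monoid_scheme \<Rightarrow> ('g, 'n) monoid_scheme \<Rightarrow> ('g, 'a) ca \<Rightarrow> ('g, 'a) ca"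
  where
  "induced_ca A G \<Gamma> \<A> = \<A>\<lparr>support := induced_subshift A G \<Gamma> (support \<A>)\<rparr>"

lemma occurs_iff:
  assumes "pattern A H p"
  shows "occurs H p c \<longleftrightarrow> (\<exists>g\<in>carrier H. \<forall>e\<in>dom p. p e = Some (c (g \<otimes>\<^bsub>H\<^esub> e)))"
proof -
  have "(Some \<circ> translate H c g) |` dom p = p \<longleftrightarrow>
        (\<forall>e\<in>dom p. p e = Some (c (g \<otimes>\<^bsub>H\<^esub> e)))" for g
  proof -
    have *: "((Some \<circ> translate H c g) |` dom p) e =
          (if e \<in> dom p then Some (c (g \<otimes>\<^bsub>H\<^esub> e)) else None)" for e
      using assms by (auto simp: restrict_map_def translate_def pattern_def)
    show ?thesis
      unfolding fun_eq_iff * by (metis domIff)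
  qed
  then show ?thesis by (simp add: occurs_def)
qed

lemma translate_in_configs:
  assumes "group H" "c \<in> configs A H" "g \<in> carrier H"
  shows "translate H c g \<in> configs A H"
proof -
  interpret group H by fact
  show ?thesis using assms by (auto simp: configs_def translate_def PiE_iff)
qed

lemma topspace_config_topology [simp]: "topspace (config_topology A H) = configs A H"
  by (simp add: config_topology_def configs_def)

lemma subshift_avoiding:
  assumes "group H" "\<forall>p\<in>\<F>. pattern A H p"
  shows "subshift A H (avoiding A H \<F>)"
proof -
  interpret group H by fact
  define M where "M g p = {c \<in> configs A H. \<forall>e\<in>dom p. p e = Some (c (g \<otimes>\<^bsub>H\<^esub> e))}" for g p
  have op: "openin (config_topology A H) (M g p)" if g: "g \<in> carrier H" and p: "p \<in> \<F>" for g p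
  proof -
    have pat: "finite (dom p)" "dom p \<subseteq> carrier H" using p assms by (auto simp: pattern_def)
    have "M g p = configs A H \<inter> (\<Inter>e\<in>dom p. {c \<in> configs A H. c (g \<otimes>\<^bsub>H\<^esub> e) \<in> {a \<in> A. p e = Some a}})"
      using g pat by (auto simp: M_def configs_def)
    moreover have "openin (config_topology A H)
        {c \<in> configs A H. c (g \<otimes>\<^bsub>H\<^esub> e) \<in> {a \<in> A. p e = Some a}}" if "e \<in> dom p" for e
    proof -
      have "g \<otimes>\<^bsub>H\<^esub> e \<in> carrier H" using that g pat by auto
      then have "continuous_map (config_topology A H) (discrete_topology A) (\<lambda>c. c (g \<otimes>\<^bsub>H\<^esub> e))"
        unfolding config_topology_def by (rule continuous_map_product_projection)
      then have "openin (config_topology A H)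
          {c \<in> topspace (config_topology A H). c (g \<otimes>\<^bsub>H\<^esub> e) \<in> {a \<in> A. p e = Some a}}"
        by (rule openin_continuous_map_preimage) auto
      then show ?thesis by simp
    qed
    moreover have "openin (config_topology A H) (configs A H)"
      using openin_topspace[of "config_topology A H"] by simp
    ultimately show ?thesis
      using pat by (cases "dom p = {}") (auto intro!: openin_Int openin_INT2)
  qed
  have eq: "avoiding A H \<F> = configs A H - (\<Union>g\<in>carrier H. \<Union>p\<in>\<F>. M g p)"
  proof -
    have "occurs H p c \<longleftrightarrow> (\<exists>g\<in>carrier H. \<forall>e\<in>dom p. p e = Some (c (g \<otimes>\<^bsub>H\<^esub> e)))"
      if "p \<in> \<F>" for p c
      using assms(2) that by (intro occurs_iff[where A = A]) blast
    then have "(\<forall>p\<in>\<F>. \<not> occurs H p c) \<longleftrightarrow> c \<notin> (\<Union>g\<in>carrier H. \<Union>p\<in>\<F>. M g p)"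
      if "c \<in> configs A H" for c
      using that by (simp add: M_def) metis
    then show ?thesis unfolding avoiding_def by blast
  qed
  have "openin (config_topology A H) (\<Union>g\<in>carrier H. \<Union>p\<in>\<F>. M g p)"
    using op by (auto intro!: openin_Union)
  then have "closedin (config_topology A H) (topspace (config_topology A H) - (\<Union>g\<in>carrier H. \<Union>p\<in>\<F>. M g p))"
    by (rule closedin_diff[OF closedin_topspace])
  then have "closedin (config_topology A H) (avoiding A H \<F>)"
    by (simp add: eq)
  moreover have "translate H c g \<in> avoiding A H \<F>"
    if c: "c \<in> avoiding A H \<F>" and g: "g \<in> carrier H" for c g
  proof -
    have cc: "c \<in> configs A H" using c by (auto simp: avoiding_def)
    have "\<not> occurs H p (translate H c g)" if p: "p \<in> \<F>" for p
    proof
      assume "occurs H p (translate H c g)"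
      moreover have pp: "pattern A H p" using p assms by blast
      ultimately obtain k where k: "k \<in> carrier H"
        "\<forall>e\<in>dom p. p e = Some (translate H c g (k \<otimes>\<^bsub>H\<^esub> e))"
        unfolding occurs_iff[OF pp] by auto
      have "\<forall>e\<in>dom p. p e = Some (c ((g \<otimes>\<^bsub>H\<^esub> k) \<otimes>\<^bsub>H\<^esub> e))"
      proof
        fix e assume e: "e \<in> dom p"
        then have "e \<in> carrier H" using pp by (auto simp: pattern_def)
        then show "p e = Some (c ((g \<otimes>\<^bsub>H\<^esub> k) \<otimes>\<^bsub>H\<^esub> e))"
          using k g e by (simp add: translate_def m_assoc)
      qed
      then have "occurs H p c" unfolding occurs_iff[OF pp] using k g by (auto intro!: bexI[of _ "g \<otimes>\<^bsub>H\<^esub> k"])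
      then show False using c p by (auto simp: avoiding_def)
    qed
    then show ?thesis using translate_in_configs[OF assms(1) cc g] by (auto simp: avoiding_def)
  qed
  ultimately show ?thesis by (auto simp: subshift_def)
qed

lemma subshift_eq_avoiding:
  assumes "group H" "subshift A H X"
  shows "\<exists>\<F>. (\<forall>p\<in>\<F>. pattern A H p) \<and> X = avoiding A H \<F>"
proof -
  interpret group H by fact
  define \<F> where "\<F> = {p. pattern A H p \<and> (\<forall>x\<in>X. \<not> occurs H p x)}"
  have XC: "X \<subseteq> configs A H"
    using assms closedin_subset by (fastforce simp: subshift_def)
  have "c \<in> X" if c: "c \<in> avoiding A H \<F>" for c
  proof (rule ccontr)
    assume "c \<notin> X"
    have cC: "c \<in> configs A H" using c by (auto simp: avoiding_def)
    have "openin (config_topology A H) (configs A H - X)"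
      using assms(2) by (auto simp: subshift_def closedin_def)
    then have "\<forall>x\<in>configs A H - X. \<exists>U. finite {i \<in> carrier H. U i \<noteq> topspace (discrete_topology A)} \<and>
        (\<forall>i\<in>carrier H. openin (discrete_topology A) (U i)) \<and>
        x \<in> Pi\<^sub>E (carrier H) U \<and> Pi\<^sub>E (carrier H) U \<subseteq> configs A H - X"
      unfolding config_topology_def openin_product_topology_alt .
    moreover have "c \<in> configs A H - X" using cC \<open>c \<notin> X\<close> by (rule DiffI)
    ultimately obtain U where U: "finite {i \<in> carrier H. U i \<noteq> topspace (discrete_topology A)}"
        "c \<in> Pi\<^sub>E (carrier H) U" "Pi\<^sub>E (carrier H) U \<subseteq> configs A H - X"
      by blast
    define E where "E = {i \<in> carrier H. U i \<noteq> A}"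
    have finE: "finite E" "E \<subseteq> carrier H" using U by (auto simp: E_def)
    define p where "p = (Some \<circ> c) |` E"
    have dom: "dom p = E" by (auto simp: p_def restrict_map_def dom_def)
    have "ran p \<subseteq> A" using cC finE
      by (auto simp: p_def ran_def restrict_map_def configs_def split: if_splits)
    then have pp: "pattern A H p" using dom finE by (auto simp: pattern_def)
    have "\<not> occurs H p x" if x: "x \<in> X" for x
    proof
      assume "occurs H p x"
      then obtain g where g: "g \<in> carrier H" "\<forall>e\<in>E. c e = x (g \<otimes>\<^bsub>H\<^esub> e)"
        unfolding occurs_iff[OF pp] dom by (auto simp: p_def restrict_in)
      have tX: "translate H x g \<in> X" using assms(2) x g by (auto simp: subshift_def)
      then have tC: "translate H x g \<in> configs A H" using XC by auto
      have "translate H x g i \<in> U i" if i: "i \<in> carrier H" for i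
      proof (cases "i \<in> E")
        case True
        then have "translate H x g i = c i" using g i by (simp add: translate_def)
        then show ?thesis using U(2) i by auto
      next
        case False
        then show ?thesis using i tC by (auto simp: E_def configs_def)
      qed
      then have "translate H x g \<in> Pi\<^sub>E (carrier H) U"
        by (auto simp: PiE_iff translate_def)
      then show False using U(3) tX by auto
    qed
    then have "p \<in> \<F>" using pp by (simp add: \<F>_def)
    moreover have "occurs H p c"
      unfolding occurs_iff[OF pp] dom
    proof (intro bexI ballI)
      fix e
      assume "e \<in> E"
      then show "p e = Some (c (\<one>\<^bsub>H\<^esub> \<otimes>\<^bsub>H\<^esub> e))" using finE by (simp add: p_def subset_iff)
    qed simp
    ultimately show False using c by (auto simp: avoiding_def)
  qed
  then have "X = avoiding A H \<F>"
    using XC unfolding avoiding_def \<F>_def by blast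
  then show ?thesis by (intro exI[of _ \<F>]) (auto simp: \<F>_def)
qed

lemma avoiding_supergroup:
  assumes "group \<Gamma>" "subgroup G \<Gamma>" "\<forall>p\<in>\<F>. pattern A (\<Gamma>\<lparr>carrier := G\<rparr>) p"
  shows "avoiding A \<Gamma> \<F> = {c \<in> configs A \<Gamma>. \<forall>g\<in>carrier \<Gamma>.
           restrict (translate \<Gamma> c g) G \<in> avoiding A (\<Gamma>\<lparr>carrier := G\<rparr>) \<F>}"
proof -
  interpret group \<Gamma> by fact
  have GS: "G \<subseteq> carrier \<Gamma>" using assms(2) by (rule subgroup.subset)
  have Gm: "x \<otimes>\<^bsub>\<Gamma>\<^esub> y \<in> G" if "x \<in> G" "y \<in> G" for x y
    using assms(2) that by (rule subgroup.m_closed)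
  have G1: "\<one>\<^bsub>\<Gamma>\<^esub> \<in> G" using assms(2) by (rule subgroup.one_closed)
  have conf: "restrict (translate \<Gamma> c g) G \<in> configs A (\<Gamma>\<lparr>carrier := G\<rparr>)"
    if "c \<in> configs A \<Gamma>" "g \<in> carrier \<Gamma>" for c g
    using translate_in_configs[OF assms(1) that] GS by (auto simp: configs_def PiE_iff)
  have occ: "occurs \<Gamma> p c \<longleftrightarrow>
      (\<exists>g\<in>carrier \<Gamma>. occurs (\<Gamma>\<lparr>carrier := G\<rparr>) p (restrict (translate \<Gamma> c g) G))" if p: "p \<in> \<F>" for p c
  proof -
    have pG: "pattern A (\<Gamma>\<lparr>carrier := G\<rparr>) p" using assms p by blast
    then have dG: "dom p \<subseteq> G" by (simp add: pattern_def)
    have pH: "pattern A \<Gamma> p" using pG GS by (auto simp: pattern_def)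
    have ev: "restrict (translate \<Gamma> c g) G (k \<otimes>\<^bsub>\<Gamma>\<^esub> e) = c ((g \<otimes>\<^bsub>\<Gamma>\<^esub> k) \<otimes>\<^bsub>\<Gamma>\<^esub> e)"
      if "g \<in> carrier \<Gamma>" "k \<in> G" "e \<in> dom p" for g k e
      using that GS dG Gm by (auto simp: translate_def m_assoc subset_iff)
    show ?thesis
    proof
      assume "occurs \<Gamma> p c"
      then obtain g where g: "g \<in> carrier \<Gamma>" "\<forall>e\<in>dom p. p e = Some (c (g \<otimes>\<^bsub>\<Gamma>\<^esub> e))"
        unfolding occurs_iff[OF pH] by auto
      have "occurs (\<Gamma>\<lparr>carrier := G\<rparr>) p (restrict (translate \<Gamma> c g) G)"
        unfolding occurs_iff[OF pG] using g ev G1 by (auto intro!: bexI[of _ "\<one>\<^bsub>\<Gamma>\<^esub>"])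
      then show "\<exists>g\<in>carrier \<Gamma>. occurs (\<Gamma>\<lparr>carrier := G\<rparr>) p (restrict (translate \<Gamma> c g) G)"
        using g by blast
    next
      assume "\<exists>g\<in>carrier \<Gamma>. occurs (\<Gamma>\<lparr>carrier := G\<rparr>) p (restrict (translate \<Gamma> c g) G)"
      then obtain g k where g: "g \<in> carrier \<Gamma>" "k \<in> G"
        "\<forall>e\<in>dom p. p e = Some (restrict (translate \<Gamma> c g) G (k \<otimes>\<^bsub>\<Gamma>\<^esub> e))"
        unfolding occurs_iff[OF pG] by auto
      then have "\<forall>e\<in>dom p. p e = Some (c ((g \<otimes>\<^bsub>\<Gamma>\<^esub> k) \<otimes>\<^bsub>\<Gamma>\<^esub> e))" using ev by simp
      then show "occurs \<Gamma> p c"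
        unfolding occurs_iff[OF pH] using g GS by (intro bexI[of _ "g \<otimes>\<^bsub>\<Gamma>\<^esub> k"]) auto
    qed
  qed
  show ?thesis
    using conf occ by (auto simp: avoiding_def)
qed

lemma induced_subshift_avoiding:
  assumes "group \<Gamma>" "subgroup G \<Gamma>" "\<forall>p\<in>\<F>. pattern A (\<Gamma>\<lparr>carrier := G\<rparr>) p"
  shows "induced_subshift A (\<Gamma>\<lparr>carrier := G\<rparr>) \<Gamma> (avoiding A (\<Gamma>\<lparr>carrier := G\<rparr>) \<F>) = avoiding A \<Gamma> \<F>"
  unfolding induced_subshift_def
proof (rule the_equality)
  show "\<exists>\<F>'. (\<forall>p\<in>\<F>'. pattern A (\<Gamma>\<lparr>carrier := G\<rparr>) p) \<and>
      avoiding A (\<Gamma>\<lparr>carrier := G\<rparr>) \<F> = avoiding A (\<Gamma>\<lparr>carrier := G\<rparr>) \<F>' \<and> avoiding A \<Gamma> \<F> = avoiding A \<Gamma> \<F>'"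
    using assms by blast
next
  fix X'
  assume "\<exists>\<F>'. (\<forall>p\<in>\<F>'. pattern A (\<Gamma>\<lparr>carrier := G\<rparr>) p) \<and>
      avoiding A (\<Gamma>\<lparr>carrier := G\<rparr>) \<F> = avoiding A (\<Gamma>\<lparr>carrier := G\<rparr>) \<F>' \<and> X' = avoiding A \<Gamma> \<F>'"
  then obtain \<F>' where F': "\<forall>p\<in>\<F>'. pattern A (\<Gamma>\<lparr>carrier := G\<rparr>) p"
    "avoiding A (\<Gamma>\<lparr>carrier := G\<rparr>) \<F> = avoiding A (\<Gamma>\<lparr>carrier := G\<rparr>) \<F>'" "X' = avoiding A \<Gamma> \<F>'"
    by blast
  show "X' = avoiding A \<Gamma> \<F>"
    unfolding F'(3) avoiding_supergroup[OF assms] avoiding_supergroup[OF assms(1,2) F'(1)] F'(2) ..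
qed

lemma induced_subshift_eq:
  assumes "group \<Gamma>" "subgroup G \<Gamma>" "subshift A (\<Gamma>\<lparr>carrier := G\<rparr>) X"
  shows "induced_subshift A (\<Gamma>\<lparr>carrier := G\<rparr>) \<Gamma> X =
           {c \<in> configs A \<Gamma>. \<forall>g\<in>carrier \<Gamma>. restrict (translate \<Gamma> c g) G \<in> X}"
proof -
  have "group (\<Gamma>\<lparr>carrier := G\<rparr>)" using assms(2,1) by (rule subgroup.subgroup_is_group)
  then obtain \<F> where F: "\<forall>p\<in>\<F>. pattern A (\<Gamma>\<lparr>carrier := G\<rparr>) p" "X = avoiding A (\<Gamma>\<lparr>carrier := G\<rparr>) \<F>"
    using subshift_eq_avoiding assms(3) by blast
  show ?thesis
    using induced_subshift_avoiding[OF assms(1,2) F(1)] avoiding_supergroup[OF assms(1,2) F(1)] F(2)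
    by simp
qed

lemma cellular_automaton_induced_ca:
  assumes "group \<Gamma>" "subgroup G \<Gamma>" "cellular_automaton A (\<Gamma>\<lparr>carrier := G\<rparr>) \<A>"
  shows "cellular_automaton A \<Gamma> (induced_ca A (\<Gamma>\<lparr>carrier := G\<rparr>) \<Gamma> \<A>)"
proof -
  interpret group \<Gamma> by fact
  let ?G = "\<Gamma>\<lparr>carrier := G\<rparr>"
  let ?N = "neighborhood \<A>"
  have GS: "G \<subseteq> carrier \<Gamma>" using assms(2) by (rule subgroup.subset)
  have Gm: "x \<otimes>\<^bsub>\<Gamma>\<^esub> y \<in> G" if "x \<in> G" "y \<in> G" for x y
    using assms(2) that by (rule subgroup.m_closed)
  have grpG: "group ?G" using assms(2,1) by (rule subgroup.subgroup_is_group)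
  have ss: "subshift A ?G (support \<A>)" and N: "finite ?N" "?N \<subseteq> G"
    and f: "local_rule \<A> \<in> (?N \<rightarrow>\<^sub>E A) \<rightarrow> A" and im: "ca_map ?G \<A> ` support \<A> \<subseteq> support \<A>"
    using assms(3) by (auto simp: cellular_automaton_def)
  obtain \<F> where F: "\<forall>p\<in>\<F>. pattern A ?G p" "support \<A> = avoiding A ?G \<F>"
    using subshift_eq_avoiding[OF grpG ss] by blast
  have "\<forall>p\<in>\<F>. pattern A \<Gamma> p" using F(1) GS by (fastforce simp: pattern_def)
  then have ss': "subshift A \<Gamma> (induced_subshift A ?G \<Gamma> (support \<A>))"
    unfolding F(2) induced_subshift_avoiding[OF assms(1,2) F(1)]
    by (rule subshift_avoiding[OF assms(1)])
  note X' = induced_subshift_eq[OF assms(1,2) ss]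
  have "ca_map \<Gamma> \<A> c \<in> induced_subshift A ?G \<Gamma> (support \<A>)"
    if c: "c \<in> induced_subshift A ?G \<Gamma> (support \<A>)" for c
  proof -
    have cC: "c \<in> configs A \<Gamma>" and cX: "\<And>g. g \<in> carrier \<Gamma> \<Longrightarrow> restrict (translate \<Gamma> c g) G \<in> support \<A>"
      using c by (auto simp: X')
    have "restrict (translate \<Gamma> c g) ?N \<in> ?N \<rightarrow>\<^sub>E A" if "g \<in> carrier \<Gamma>" for g
      using translate_in_configs[OF assms(1) cC that] N GS by (auto simp: configs_def PiE_iff)
    then have "local_rule \<A> (restrict (translate \<Gamma> c g) ?N) \<in> A" if "g \<in> carrier \<Gamma>" for g
      by (rule funcset_mem[OF f]) (use that in blast)
    then have 1: "ca_map \<Gamma> \<A> c \<in> configs A \<Gamma>"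
      by (simp add: configs_def ca_map_def)
    have 2: "restrict (translate \<Gamma> (ca_map \<Gamma> \<A> c) g) G = ca_map ?G \<A> (restrict (translate \<Gamma> c g) G)"
      if g: "g \<in> carrier \<Gamma>" for g
    proof
      fix k
      show "restrict (translate \<Gamma> (ca_map \<Gamma> \<A> c) g) G k = ca_map ?G \<A> (restrict (translate \<Gamma> c g) G) k"
      proof (cases "k \<in> G")
        case True
        then have k: "k \<in> carrier \<Gamma>" using GS by auto
        have "restrict (translate \<Gamma> c (g \<otimes>\<^bsub>\<Gamma>\<^esub> k)) ?N =
              restrict (translate ?G (restrict (translate \<Gamma> c g) G) k) ?N"
          using N GS k g True Gm by (auto simp: translate_def restrict_def m_assoc fun_eq_iff subset_iff)
        then show ?thesis using True k g by (simp add: ca_map_def translate_def)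
      next
        case False
        then show ?thesis by (simp add: ca_map_def)
      qed
    qed
    show ?thesis
      unfolding X' using 1 2 cX im by auto
  qed
  moreover have "ca_map \<Gamma> (induced_ca A ?G \<Gamma> \<A>) = ca_map \<Gamma> \<A>"
    by (simp add: induced_ca_def ca_map_def fun_eq_iff)
  ultimately show ?thesis
    using ss' N f GS unfolding cellular_automaton_def by (auto simp: induced_ca_def)
qed

end

theory Submission
  imports Defs
begin

text \<open>
  Cut \<open>\<Gamma>\<close> into its left cosets \<open>g G\<close>. Reading a configuration of \<open>A\<^sup>\<Gamma>\<close> along the coset \<open>g G\<close>
  gives a configuration of \<open>A\<^sup>G\<close>, its slice at \<open>g\<close>. The induced support \<open>X'\<close> consists of the
  configurations all of whose slices lie in \<open>X\<close>, and since the neighborhood is contained in \<open>G\<close>,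
  the induced global map acts on each slice separately, as the global map over \<open>G\<close>
  (\<open>slice_ca_map\<close>).

  Fixing one representative in every coset turns this into a product decomposition: a family of
  members of \<open>X\<close> indexed by the representatives is the family of slices at the
  representatives of exactly one member of \<open>X'\<close> (\<open>glue_in_lift\<close>, \<open>slice_glue\<close>, \<open>eq_if_slices_eq\<close>). So \<open>X'\<close> with its global map is a
  power of \<open>X\<close> with its global map. Surjectivity and injectivity of a nonempty power of a map are
  equivalent to those of the map; and a finite nonempty difference in \<open>X'\<close> gives a finite nonempty
  difference in some slice, while conversely a finite difference in \<open>X\<close> can be planted in one
  single coset.
\<close>

section \<open>Slices along left cosets\<close>

definition slice :: "('g, 'm) monoid_scheme \<Rightarrow> 'g set \<Rightarrow> ('g \<Rightarrow> 'a) \<Rightarrow> 'g \<Rightarrow> 'g \<Rightarrow> 'a" where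
  "slice \<Gamma> G c g = restrict (translate \<Gamma> c g) G"

definition lift_subshift ::
  "'a set \<Rightarrow> ('g, 'm) monoid_scheme \<Rightarrow> 'g set \<Rightarrow> ('g \<Rightarrow> 'a) set \<Rightarrow> ('g \<Rightarrow> 'a) set" where
  "lift_subshift A \<Gamma> G X = {c \<in> configs A \<Gamma>. \<forall>g\<in>carrier \<Gamma>. slice \<Gamma> G c g \<in> X}"

definition coset_rep :: "('g, 'm) monoid_scheme \<Rightarrow> 'g set \<Rightarrow> 'g \<Rightarrow> 'g" where
  "coset_rep \<Gamma> G h = (SOME k. k \<in> h <#\<^bsub>\<Gamma>\<^esub> G)"

text \<open>The configuration whose slice at each representative \<open>j\<close> is the prescribed \<open>x j\<close>: a point
  \<open>h\<close> is written as \<open>j g\<close> with \<open>g \<in> G\<close>, and receives the value \<open>x j g\<close>.\<close>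

definition glue :: "('g, 'm) monoid_scheme \<Rightarrow> 'g set \<Rightarrow> ('g \<Rightarrow> 'g \<Rightarrow> 'a) \<Rightarrow> 'g \<Rightarrow> 'a" where
  "glue \<Gamma> G x = (\<lambda>h\<in>carrier \<Gamma>. x (coset_rep \<Gamma> G h) (inv\<^bsub>\<Gamma>\<^esub> coset_rep \<Gamma> G h \<otimes>\<^bsub>\<Gamma>\<^esub> h))"

locale group_with_subgroup = group \<Gamma> for \<Gamma> :: "('g, 'm) monoid_scheme" (structure) +
  fixes G :: "'g set"
  assumes subgroup_G: "subgroup G \<Gamma>"
begin

abbreviation sub :: "('g, 'm) monoid_scheme" where
  "sub \<equiv> \<Gamma>\<lparr>carrier := G\<rparr>"

lemma G_closed [simp, intro]:
  "x \<in> G \<Longrightarrow> x \<in> carrier \<Gamma>" "\<one> \<in> G"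
  "x \<in> G \<Longrightarrow> y \<in> G \<Longrightarrow> x \<otimes> y \<in> G" "x \<in> G \<Longrightarrow> inv x \<in> G"
  using subgroup_G
  by (auto intro: subgroup.mem_carrier subgroup.one_closed subgroup.m_closed subgroup.m_inv_closed)

lemma slice_apply:
  "g \<in> carrier \<Gamma> \<Longrightarrow> k \<in> G \<Longrightarrow> slice \<Gamma> G c g k = c (g \<otimes> k)"
  by (simp add: slice_def translate_def)

lemma induced_subshift_eq_lift:
  "subshift A sub X \<Longrightarrow> induced_subshift A sub \<Gamma> X = lift_subshift A \<Gamma> G X"
  using induced_subshift_eq[OF is_group subgroup_G] by (simp add: lift_subshift_def slice_def)

text \<open>The value of the global map at \<open>g k\<close> only depends on the values at \<open>g k n\<close> with \<open>n\<close> in the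
  neighborhood, and for \<open>k, n \<in> G\<close> these all lie in the coset \<open>g G\<close>.\<close>

lemma slice_ca_map:
  assumes N: "neighborhood \<A> \<subseteq> G" and g: "g \<in> carrier \<Gamma>"
  shows "slice \<Gamma> G (ca_map \<Gamma> \<A> c) g = ca_map sub \<A> (slice \<Gamma> G c g)"
proof
  fix k
  show "slice \<Gamma> G (ca_map \<Gamma> \<A> c) g k = ca_map sub \<A> (slice \<Gamma> G c g) k"
  proof (cases "k \<in> G")
    case True
    have "restrict (translate \<Gamma> c (g \<otimes> k)) (neighborhood \<A>) =
          restrict (translate sub (slice \<Gamma> G c g) k) (neighborhood \<A>)"
    proof (rule restrict_ext)
      fix n assume "n \<in> neighborhood \<A>"
      then have n: "n \<in> G" using N by auto
      show "translate \<Gamma> c (g \<otimes> k) n = translate sub (slice \<Gamma> G c g) k n"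
        using n True g by (simp add: translate_def slice_apply m_assoc)
    qed
    then show ?thesis using True g by (simp add: ca_map_def slice_apply)
  next
    case False
    then show ?thesis by (simp add: ca_map_def slice_def)
  qed
qed

section \<open>Gluing slices along a transversal\<close>

text \<open>The element \<open>inv (coset_rep \<Gamma> G h) \<otimes> h\<close> is the coordinate of \<open>h\<close> inside its coset.\<close>

lemma coset_rep:
  assumes h: "h \<in> carrier \<Gamma>"
  shows "coset_rep \<Gamma> G h \<in> carrier \<Gamma>" and "inv (coset_rep \<Gamma> G h) \<otimes> h \<in> G"
proof -
  have "h \<in> h <# G"
    using h by (auto simp: l_coset_def intro!: bexI[of _ \<one>])
  then have "coset_rep \<Gamma> G h \<in> h <# G"
    unfolding coset_rep_def by (rule someI)
  then obtain k where k: "k \<in> G" "coset_rep \<Gamma> G h = h \<otimes> k"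
    by (auto simp: l_coset_def)
  show "coset_rep \<Gamma> G h \<in> carrier \<Gamma>" using k h by simp
  have "inv (h \<otimes> k) \<otimes> h = inv k"
    using k h by (simp add: inv_mult_group m_assoc)
  then show "inv (coset_rep \<Gamma> G h) \<otimes> h \<in> G" using k by simp
qed

lemma coset_rep_mult:
  assumes "h \<in> carrier \<Gamma>" "k \<in> G"
  shows "coset_rep \<Gamma> G (h \<otimes> k) = coset_rep \<Gamma> G h"
proof -
  have "h \<otimes> k \<in> h <# G" using assms by (auto simp: l_coset_def)
  then have "(h \<otimes> k) <# G = h <# G"
    using l_repr_independence[OF _ assms(1) subgroup_G] by simp
  then show ?thesis by (simp add: coset_rep_def)
qed

lemma coset_rep_idem [simp]:
  assumes h: "h \<in> carrier \<Gamma>"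
  shows "coset_rep \<Gamma> G (coset_rep \<Gamma> G h) = coset_rep \<Gamma> G h"
proof -
  let ?j = "coset_rep \<Gamma> G h"
  have "coset_rep \<Gamma> G (?j \<otimes> (inv ?j \<otimes> h)) = coset_rep \<Gamma> G ?j"
    using coset_rep[OF h] by (rule coset_rep_mult)
  moreover have "?j \<otimes> (inv ?j \<otimes> h) = h"
    using coset_rep(1)[OF h] h by (simp add: m_assoc[symmetric])
  ultimately show ?thesis by simp
qed

text \<open>Off the transversal, a slice of a glued configuration is a translate of the prescribed
  configuration of its coset; this is where the translation invariance of \<open>X\<close> enters.\<close>

lemma slice_glue_translate:
  assumes g: "g \<in> carrier \<Gamma>"
  shows "slice \<Gamma> G (glue \<Gamma> G x) g =
         translate sub (x (coset_rep \<Gamma> G g)) (inv (coset_rep \<Gamma> G g) \<otimes> g)"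
proof
  fix k
  show "slice \<Gamma> G (glue \<Gamma> G x) g k =
        translate sub (x (coset_rep \<Gamma> G g)) (inv (coset_rep \<Gamma> G g) \<otimes> g) k"
  proof (cases "k \<in> G")
    case True
    then show ?thesis
      using g coset_rep[OF g]
      by (simp add: slice_apply glue_def coset_rep_mult translate_def m_assoc)
  next
    case False
    then show ?thesis by (simp add: slice_def translate_def)
  qed
qed

lemma slice_glue:
  assumes h: "h \<in> carrier \<Gamma>" and x: "x (coset_rep \<Gamma> G h) \<in> configs A sub"
  shows "slice \<Gamma> G (glue \<Gamma> G x) (coset_rep \<Gamma> G h) = x (coset_rep \<Gamma> G h)"
proof -
  let ?j = "coset_rep \<Gamma> G h"
  have "slice \<Gamma> G (glue \<Gamma> G x) ?j = translate sub (x ?j) \<one>"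
    using coset_rep(1)[OF h] h by (simp add: slice_glue_translate)
  also have "\<dots> = x ?j"
  proof
    fix k show "translate sub (x ?j) \<one> k = x ?j k"
    proof (cases "k \<in> G")
      case True
      then show ?thesis by (simp add: translate_def)
    next
      case False
      then show ?thesis
        using PiE_arb[OF x[unfolded configs_def], of k] by (simp add: translate_def)
    qed
  qed
  finally show ?thesis .
qed

lemma glue_in_lift:
  assumes X: "subshift A sub X" "X \<subseteq> configs A sub"
    and x: "\<And>h. h \<in> carrier \<Gamma> \<Longrightarrow> x (coset_rep \<Gamma> G h) \<in> X"
  shows "glue \<Gamma> G x \<in> lift_subshift A \<Gamma> G X"
proof -
  have "glue \<Gamma> G x h \<in> A" if h: "h \<in> carrier \<Gamma>" for h
  proof -
    have "x (coset_rep \<Gamma> G h) \<in> G \<rightarrow>\<^sub>E A" using x[OF h] X(2) by (auto simp: configs_def)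
    then show ?thesis using coset_rep(2)[OF h] h by (auto simp: glue_def)
  qed
  then have "glue \<Gamma> G x \<in> configs A \<Gamma>"
    by (auto simp: configs_def glue_def)
  moreover have "slice \<Gamma> G (glue \<Gamma> G x) g \<in> X" if g: "g \<in> carrier \<Gamma>" for g
    unfolding slice_glue_translate[OF g]
    using X(1) x[OF g] coset_rep(2)[OF g] by (simp add: subshift_def)
  ultimately show ?thesis by (simp add: lift_subshift_def)
qed

lemma eq_if_slices_eq:
  assumes c: "c \<in> extensional (carrier \<Gamma>)" and d: "d \<in> extensional (carrier \<Gamma>)"
    and eq: "\<And>h. h \<in> carrier \<Gamma> \<Longrightarrow>
      slice \<Gamma> G c (coset_rep \<Gamma> G h) = slice \<Gamma> G d (coset_rep \<Gamma> G h)"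
  shows "c = d"
proof (rule extensionalityI[OF c d])
  fix h assume h: "h \<in> carrier \<Gamma>"
  let ?j = "coset_rep \<Gamma> G h"
  have h': "?j \<otimes> (inv ?j \<otimes> h) = h"
    using coset_rep(1)[OF h] h by (simp add: m_assoc[symmetric])
  have "c (?j \<otimes> (inv ?j \<otimes> h)) = d (?j \<otimes> (inv ?j \<otimes> h))"
    using fun_cong[OF eq[OF h], of "inv ?j \<otimes> h"] coset_rep[OF h] by (simp add: slice_apply)
  then show "c h = d h" by (simp add: h')
qed

end

section \<open>Transfer of the three properties\<close>

locale lifted_ca = group_with_subgroup \<Gamma> G
  for \<Gamma> :: "('g, 'm) monoid_scheme" (structure) and G :: "'g set" +
  fixes A :: "'a set" and \<A> :: "('g, 'a) ca"
  assumes ca: "cellular_automaton A sub \<A>"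
begin

abbreviation X where "X \<equiv> support \<A>"
abbreviation X' where "X' \<equiv> lift_subshift A \<Gamma> G X"

lemma X_subshift: "subshift A sub X"
  and N_subset: "neighborhood \<A> \<subseteq> G"
  and ca_map_in_X: "x \<in> X \<Longrightarrow> ca_map sub \<A> x \<in> X"
  using ca by (auto simp: cellular_automaton_def)

lemma X_configs: "X \<subseteq> configs A sub"
  using X_subshift closedin_subset by (fastforce simp: subshift_def)

lemma support_induced_ca: "support (induced_ca A sub \<Gamma> \<A>) = X'"
  by (simp add: induced_ca_def induced_subshift_eq_lift[OF X_subshift])

lemma ca_map_induced_ca: "ca_map \<Gamma> (induced_ca A sub \<Gamma> \<A>) = ca_map \<Gamma> \<A>"
  by (simp add: induced_ca_def ca_map_def fun_eq_iff)

lemma slice_in_X: "c \<in> X' \<Longrightarrow> g \<in> carrier \<Gamma> \<Longrightarrow> slice \<Gamma> G c g \<in> X"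
  by (simp add: lift_subshift_def)

lemma lift_extensional: "c \<in> X' \<Longrightarrow> c \<in> extensional (carrier \<Gamma>)"
  by (auto simp: lift_subshift_def configs_def PiE_def)

lemma ca_map_extensional: "ca_map \<Gamma> \<A> c \<in> extensional (carrier \<Gamma>)"
  by (simp add: ca_map_def)

lemma ca_map_in_lift: "c \<in> X' \<Longrightarrow> ca_map \<Gamma> \<A> c \<in> X'"
  using cellular_automaton_induced_ca[OF is_group subgroup_G ca]
  by (auto simp: cellular_automaton_def support_induced_ca ca_map_induced_ca)

lemma slice_glue_X:
  "h \<in> carrier \<Gamma> \<Longrightarrow> x (coset_rep \<Gamma> G h) \<in> X \<Longrightarrow>
   slice \<Gamma> G (glue \<Gamma> G x) (coset_rep \<Gamma> G h) = x (coset_rep \<Gamma> G h)"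
  using slice_glue X_configs by blast

lemma glue_const_in_lift: "x \<in> X \<Longrightarrow> glue \<Gamma> G (\<lambda>_. x) \<in> X'"
  using X_subshift X_configs by (rule glue_in_lift)

text \<open>The global map acts on glued configurations factor by factor.\<close>

lemma ca_map_glue_eqI:
  assumes "\<And>h. h \<in> carrier \<Gamma> \<Longrightarrow> x (coset_rep \<Gamma> G h) \<in> X"
    and "d \<in> extensional (carrier \<Gamma>)"
    and "\<And>h. h \<in> carrier \<Gamma> \<Longrightarrow>
      ca_map sub \<A> (x (coset_rep \<Gamma> G h)) = slice \<Gamma> G d (coset_rep \<Gamma> G h)"
  shows "ca_map \<Gamma> \<A> (glue \<Gamma> G x) = d"
  using ca_map_extensional assms(2)
proof (rule eq_if_slices_eq)
  fix h assume h: "h \<in> carrier \<Gamma>"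
  show "slice \<Gamma> G (ca_map \<Gamma> \<A> (glue \<Gamma> G x)) (coset_rep \<Gamma> G h) = slice \<Gamma> G d (coset_rep \<Gamma> G h)"
    using slice_ca_map[OF N_subset coset_rep(1)[OF h]] slice_glue_X[where x = x, OF h assms(1)[OF h]]
      assms(3)[OF h] by simp
qed

lemma ca_map_glue_cong:
  assumes "\<And>h. h \<in> carrier \<Gamma> \<Longrightarrow> x (coset_rep \<Gamma> G h) \<in> X"
    and y: "\<And>h. h \<in> carrier \<Gamma> \<Longrightarrow> y (coset_rep \<Gamma> G h) \<in> X"
    and "\<And>h. h \<in> carrier \<Gamma> \<Longrightarrow>
      ca_map sub \<A> (x (coset_rep \<Gamma> G h)) = ca_map sub \<A> (y (coset_rep \<Gamma> G h))"
  shows "ca_map \<Gamma> \<A> (glue \<Gamma> G x) = ca_map \<Gamma> \<A> (glue \<Gamma> G y)"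
proof (rule ca_map_glue_eqI[where x = x, OF assms(1) ca_map_extensional])
  fix h assume h: "h \<in> carrier \<Gamma>"
  show "ca_map sub \<A> (x (coset_rep \<Gamma> G h)) =
      slice \<Gamma> G (ca_map \<Gamma> \<A> (glue \<Gamma> G y)) (coset_rep \<Gamma> G h)"
    using slice_ca_map[OF N_subset coset_rep(1)[OF h]] slice_glue_X[where x = y, OF h y[OF h]]
      assms(3)[OF h] by simp
qed

text \<open>Upwards, preimages of the slices are chosen independently and glued. Downwards, a member
  of \<open>X\<close> is copied into every coset, and a preimage of that is read off in one coset.\<close>

lemma surjective_iff:
  "ca_surjective sub \<A> \<longleftrightarrow> ca_surjective \<Gamma> (induced_ca A sub \<Gamma> \<A>)"
proof
  assume "ca_surjective sub \<A>"
  then have sur: "\<forall>y\<in>X. \<exists>x\<in>X. ca_map sub \<A> x = y"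
    unfolding ca_surjective_def by (metis imageE)
  have "d \<in> ca_map \<Gamma> \<A> ` X'" if d: "d \<in> X'" for d
  proof -
    have "\<forall>j\<in>carrier \<Gamma>. \<exists>x\<in>X. ca_map sub \<A> x = slice \<Gamma> G d j"
      using sur slice_in_X[OF d] by blast
    then obtain x where x: "\<And>j. j \<in> carrier \<Gamma> \<Longrightarrow> x j \<in> X"
      "\<And>j. j \<in> carrier \<Gamma> \<Longrightarrow> ca_map sub \<A> (x j) = slice \<Gamma> G d j"
      by metis
    have "ca_map \<Gamma> \<A> (glue \<Gamma> G x) = d"
      by (rule ca_map_glue_eqI) (use x coset_rep(1) lift_extensional[OF d] in auto)
    moreover have "glue \<Gamma> G x \<in> X'"
      using X_subshift X_configs by (rule glue_in_lift) (use x coset_rep(1) in auto)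
    ultimately show ?thesis by blast
  qed
  then show "ca_surjective \<Gamma> (induced_ca A sub \<Gamma> \<A>)"
    using ca_map_in_lift by (auto simp: ca_surjective_def support_induced_ca ca_map_induced_ca)
next
  assume "ca_surjective \<Gamma> (induced_ca A sub \<Gamma> \<A>)"
  then have sur: "ca_map \<Gamma> \<A> ` X' = X'"
    by (simp add: ca_surjective_def support_induced_ca ca_map_induced_ca)
  let ?j = "coset_rep \<Gamma> G \<one>"
  have j: "?j \<in> carrier \<Gamma>" by (simp add: coset_rep(1))
  have "y \<in> ca_map sub \<A> ` X" if y: "y \<in> X" for y
  proof -
    have "glue \<Gamma> G (\<lambda>_. y) \<in> ca_map \<Gamma> \<A> ` X'"
      unfolding sur using y by (rule glue_const_in_lift)
    then obtain c where c: "c \<in> X'" "ca_map \<Gamma> \<A> c = glue \<Gamma> G (\<lambda>_. y)"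
      by (metis imageE)
    have "ca_map sub \<A> (slice \<Gamma> G c ?j) = slice \<Gamma> G (glue \<Gamma> G (\<lambda>_. y)) ?j"
      using slice_ca_map[OF N_subset j, of c] c(2) by simp
    also have "\<dots> = y" using slice_glue_X[of \<one> "\<lambda>_. y"] y by simp
    finally show ?thesis using slice_in_X[OF c(1) j] by force
  qed
  then show "ca_surjective sub \<A>"
    using ca_map_in_X by (auto simp: ca_surjective_def)
qed

lemma injective_iff:
  "ca_injective sub \<A> \<longleftrightarrow> ca_injective \<Gamma> (induced_ca A sub \<Gamma> \<A>)"
proof
  assume inj: "ca_injective sub \<A>"
  have "inj_on (ca_map \<Gamma> \<A>) X'"
  proof (rule inj_onI)
    fix c d assume cd: "c \<in> X'" "d \<in> X'" "ca_map \<Gamma> \<A> c = ca_map \<Gamma> \<A> d"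
    show "c = d"
    proof (rule eq_if_slices_eq)
      fix h assume "h \<in> carrier \<Gamma>"
      then have j: "coset_rep \<Gamma> G h \<in> carrier \<Gamma>" by (rule coset_rep(1))
      then have "ca_map sub \<A> (slice \<Gamma> G c (coset_rep \<Gamma> G h)) =
          ca_map sub \<A> (slice \<Gamma> G d (coset_rep \<Gamma> G h))"
        using cd(3) slice_ca_map[OF N_subset j, of c] slice_ca_map[OF N_subset j, of d] by simp
      then show "slice \<Gamma> G c (coset_rep \<Gamma> G h) = slice \<Gamma> G d (coset_rep \<Gamma> G h)"
        using inj slice_in_X[OF cd(1) j] slice_in_X[OF cd(2) j]
        by (auto simp: ca_injective_def dest: inj_onD)
    qed (use cd lift_extensional in auto)
  qed
  then show "ca_injective \<Gamma> (induced_ca A sub \<Gamma> \<A>)"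
    by (simp add: ca_injective_def support_induced_ca ca_map_induced_ca)
next
  assume "ca_injective \<Gamma> (induced_ca A sub \<Gamma> \<A>)"
  then have inj: "inj_on (ca_map \<Gamma> \<A>) X'"
    by (simp add: ca_injective_def support_induced_ca ca_map_induced_ca)
  have "inj_on (ca_map sub \<A>) X"
  proof (rule inj_onI)
    fix x y assume xy: "x \<in> X" "y \<in> X" "ca_map sub \<A> x = ca_map sub \<A> y"
    have "ca_map \<Gamma> \<A> (glue \<Gamma> G (\<lambda>_. x)) = ca_map \<Gamma> \<A> (glue \<Gamma> G (\<lambda>_. y))"
      using xy by (intro ca_map_glue_cong)
    then have eq: "glue \<Gamma> G (\<lambda>_. x) = glue \<Gamma> G (\<lambda>_. y)"
      by (rule inj_onD[OF inj]) (use xy in \<open>simp_all add: glue_const_in_lift\<close>)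
    have "x = slice \<Gamma> G (glue \<Gamma> G (\<lambda>_. x)) (coset_rep \<Gamma> G \<one>)"
      using slice_glue_X[of \<one> "\<lambda>_. x"] xy(1) by simp
    also have "\<dots> = slice \<Gamma> G (glue \<Gamma> G (\<lambda>_. y)) (coset_rep \<Gamma> G \<one>)"
      by (simp only: eq)
    also have "\<dots> = y"
      using slice_glue_X[of \<one> "\<lambda>_. y"] xy(2) by simp
    finally show "x = y" .
  qed
  then show "ca_injective sub \<A>" by (simp add: ca_injective_def)
qed

text \<open>Upwards, the slice through a point of difference still differs, in a set that left
  multiplication embeds into the given finite one. Downwards, the copying construction has to be
  modified, as it would repeat the difference in every coset: one of the two configurations is used
  in all cosets but one.\<close>

lemma preinjective_iff:
  "ca_preinjective sub \<A> \<longleftrightarrow> ca_preinjective \<Gamma> (induced_ca A sub \<Gamma> \<A>)"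
proof
  assume pre: "ca_preinjective sub \<A>"
  have "ca_map \<Gamma> \<A> c \<noteq> ca_map \<Gamma> \<A> d"
    if cd: "c \<in> X'" "d \<in> X'" and fin: "finite {h \<in> carrier \<Gamma>. c h \<noteq> d h}"
      and ne: "{h \<in> carrier \<Gamma>. c h \<noteq> d h} \<noteq> {}" for c d
  proof
    assume eq: "ca_map \<Gamma> \<A> c = ca_map \<Gamma> \<A> d"
    obtain g where g: "g \<in> carrier \<Gamma>" "c g \<noteq> d g" using ne by auto
    let ?D = "{k \<in> G. slice \<Gamma> G c g k \<noteq> slice \<Gamma> G d g k}"
    have "(\<lambda>k. g \<otimes> k) ` ?D \<subseteq> {h \<in> carrier \<Gamma>. c h \<noteq> d h}"
      using g(1) by (auto simp: slice_apply)
    moreover have "inj_on (\<lambda>k. g \<otimes> k) ?D"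
      using g(1) by (auto intro!: inj_onI)
    ultimately have "finite ?D"
      using finite_imageD[OF finite_subset[OF _ fin]] by blast
    moreover have "\<one> \<in> ?D"
      using g by (simp add: slice_apply)
    ultimately have "ca_map sub \<A> (slice \<Gamma> G c g) \<noteq> ca_map sub \<A> (slice \<Gamma> G d g)"
      using pre[unfolded ca_preinjective_def, rule_format,
          OF slice_in_X[OF cd(1) g(1)] slice_in_X[OF cd(2) g(1)]] by auto
    then show False
      using eq slice_ca_map[OF N_subset g(1), of c] slice_ca_map[OF N_subset g(1), of d] by simp
  qed
  then show "ca_preinjective \<Gamma> (induced_ca A sub \<Gamma> \<A>)"
    by (simp add: ca_preinjective_def support_induced_ca ca_map_induced_ca)
next
  assume "ca_preinjective \<Gamma> (induced_ca A sub \<Gamma> \<A>)"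
  then have pre: "ca_map \<Gamma> \<A> c \<noteq> ca_map \<Gamma> \<A> d"
    if "c \<in> X'" "d \<in> X'" "finite {h \<in> carrier \<Gamma>. c h \<noteq> d h}" "{h \<in> carrier \<Gamma>. c h \<noteq> d h} \<noteq> {}"
    for c d
    using that by (simp add: ca_preinjective_def support_induced_ca ca_map_induced_ca)
  let ?j = "coset_rep \<Gamma> G \<one>"
  have j: "?j \<in> carrier \<Gamma>" by (simp add: coset_rep(1))
  have "ca_map sub \<A> x \<noteq> ca_map sub \<A> y"
    if xy: "x \<in> X" "y \<in> X" and fin: "finite {k \<in> G. x k \<noteq> y k}"
      and ne: "{k \<in> G. x k \<noteq> y k} \<noteq> {}" for x y
  proof
    assume eq: "ca_map sub \<A> x = ca_map sub \<A> y"
    define c where "c = glue \<Gamma> G (\<lambda>_. x)"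
    define d where "d = glue \<Gamma> G ((\<lambda>_. x)(?j := y))"
    have c: "c \<in> X'" and d: "d \<in> X'"
      unfolding c_def d_def
      using glue_in_lift[OF X_subshift X_configs] xy by (auto simp: fun_upd_apply)
    have "{h \<in> carrier \<Gamma>. c h \<noteq> d h} \<subseteq> (\<lambda>k. ?j \<otimes> k) ` {k \<in> G. x k \<noteq> y k}"
    proof
      fix h assume "h \<in> {h \<in> carrier \<Gamma>. c h \<noteq> d h}"
      then have h: "h \<in> carrier \<Gamma>" "c h \<noteq> d h" by auto
      then have hj: "coset_rep \<Gamma> G h = ?j"
        by (auto simp: c_def d_def glue_def split: if_splits)
      then have "x (inv ?j \<otimes> h) \<noteq> y (inv ?j \<otimes> h)"
        using h by (simp add: c_def d_def glue_def)
      moreover have "inv ?j \<otimes> h \<in> G" using coset_rep(2)[OF h(1)] hj by simp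
      moreover have "h = ?j \<otimes> (inv ?j \<otimes> h)" using j h by (simp add: m_assoc[symmetric])
      ultimately show "h \<in> (\<lambda>k. ?j \<otimes> k) ` {k \<in> G. x k \<noteq> y k}" by blast
    qed
    then have "finite {h \<in> carrier \<Gamma>. c h \<noteq> d h}"
      using fin by (meson finite_imageI finite_subset)
    moreover have "{h \<in> carrier \<Gamma>. c h \<noteq> d h} \<noteq> {}"
    proof -
      obtain k where k: "k \<in> G" "x k \<noteq> y k" using ne by auto
      have "slice \<Gamma> G c ?j = x" "slice \<Gamma> G d ?j = y"
        using slice_glue_X[of \<one> "\<lambda>_. x"] slice_glue_X[of \<one> "(\<lambda>_. x)(?j := y)"] xy
        by (simp_all add: c_def d_def)
      then have "c (?j \<otimes> k) \<noteq> d (?j \<otimes> k)"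
        using k j by (metis slice_apply)
      then show ?thesis using j k by auto
    qed
    moreover have "ca_map \<Gamma> \<A> c = ca_map \<Gamma> \<A> d"
      unfolding c_def d_def using xy eq by (intro ca_map_glue_cong) auto
    ultimately show False using pre[OF c d] by blast
  qed
  then show "ca_preinjective sub \<A>"
    by (simp add: ca_preinjective_def)
qed

end

theorem theorem2:
  fixes \<Gamma> :: "('g, 'm) monoid_scheme" and G :: "'g set"
    and A :: "'a set" and \<A> :: "('g, 'a) ca"
  assumes "finitely_generated_group \<Gamma>"
    and "subgroup G \<Gamma>"
    and "finitely_generated_group (\<Gamma>\<lparr>carrier := G\<rparr>)"
    and "alphabet A"
    and "cellular_automaton A (\<Gamma>\<lparr>carrier := G\<rparr>) \<A>"
  shows "(ca_surjective (\<Gamma>\<lparr>carrier := G\<rparr>) \<A> \<longleftrightarrow> ca_surjective \<Gamma> (induced_ca A (\<Gamma>\<lparr>carrier := G\<rparr>) \<Gamma> \<A>)) \<and>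
         (ca_preinjective (\<Gamma>\<lparr>carrier := G\<rparr>) \<A> \<longleftrightarrow> ca_preinjective \<Gamma> (induced_ca A (\<Gamma>\<lparr>carrier := G\<rparr>) \<Gamma> \<A>)) \<and>
         (ca_injective (\<Gamma>\<lparr>carrier := G\<rparr>) \<A> \<longleftrightarrow> ca_injective \<Gamma> (induced_ca A (\<Gamma>\<lparr>carrier := G\<rparr>) \<Gamma> \<A>))"
proof -
  interpret group \<Gamma>
    using assms(1) by (simp add: finitely_generated_group_def)
  interpret lifted_ca \<Gamma> G A \<A>
    by (intro lifted_ca.intro group_with_subgroup.intro group_with_subgroup_axioms.intro
        lifted_ca_axioms.intro is_group assms)
  show ?thesis
    using surjective_iff preinjective_iff injective_iff by blast
qed

end
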